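(* Let $\mathcal{M}=(S,\rightarrow,\ell)$ be a WTS. Generalized weighted bisimilarity $\sim$ on $\mathcal{M}$ is itself a generalized weighted bisimulation relation, and every generalized weighted bisimulation relation on $\mathcal{M}$ is contained in $\sim$; i.e. $\sim$ is the largest generalized weighted bisimulation relation.
   Context: Fix a set $\mathcal{AP}$ of atomic propositions. A weighted transition system (WTS) is a triple $\mathcal{M}=(S,\rightarrow,\ell)$ where $S$ is a non-empty set of states, $\rightarrow\subseteq S\times\mathbb{R}_{\ge 0}\times S$ is a transition relation (write $s\xrightarrow{r}t$), and $\ell:S\to 2^{\mathcal{AP}}$ is a labeling. For $s\in S$, $T\subseteq S$ let $\theta(s)(T)=\{r\mid \exists t\in T,\ s\xrightarrow{r}t\}$; $\theta^-(s)(T)=-\infty$ if $\theta(s)(T)=\emptyset$, else $\inf\theta(s)(T)$; $\theta^+(s)(T)=\infty$ if $\theta(s)(T)=\emptyset$, else $\sup\theta(s)(T)$. A generalized weighted bisimulation relation on $\mathcal{M}$ is an equivalence relation $\mathcal{R}$ on $S$ such that whenever $s\mathcal{R}t$: $\ell(s)=\ell(t)$, and for every $\mathcal{R}$-equivalence class $T$, $\theta^-(s)(T)=\theta^-(t)(T)$ and $\theta^+(s)(T)=\theta^+(t)(T)$. Generalized weighted bisimilarity $\sim$ is the union of all generalized weighted bisimulation relations on $\mathcal{M}$. *)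

theory Defs
  imports "HOL-Library.Extended_Real" "HOL-Library.FuncSet"
begin

record ('s, 'p) wts =
  states :: "'s set"
  transitions :: "('s \<times> real \<times> 's) set"
  label :: "'s \<Rightarrow> 'p set"

text \<open>
  \<open>AP\<close> is the fixed set of atomic propositions; it may be empty or infinite.
  The labeling is a function on \<open>states M\<close>: its values elsewhere are irrelevant.
\<close>

definition is_wts :: "'p set \<Rightarrow> ('s, 'p) wts \<Rightarrow> bool" where
  "is_wts AP M \<longleftrightarrow>
     states M \<noteq> {} \<and>
     transitions M \<subseteq> states M \<times> {0..} \<times> states M \<and>
     label M \<in> states M \<rightarrow> Pow AP"

definition theta :: "('s, 'p) wts \<Rightarrow> 's \<Rightarrow> 's set \<Rightarrow> real set" where
  "theta M s T = {r. \<exists>t\<in>T. (s, r, t) \<in> transitions M}"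

text \<open>
  The bounds are extended reals, so the supremum of a nonempty unbounded set of weights
  is \<open>\<infinity>\<close>. For the empty set, note that the convention is the opposite of
  \<open>Inf {} = \<infinity>\<close> and \<open>Sup {} = -\<infinity>\<close>.
\<close>

definition theta_minus :: "('s, 'p) wts \<Rightarrow> 's \<Rightarrow> 's set \<Rightarrow> ereal" where
  "theta_minus M s T = (if theta M s T = {} then -\<infinity> else Inf (ereal ` theta M s T))"

definition theta_plus :: "('s, 'p) wts \<Rightarrow> 's \<Rightarrow> 's set \<Rightarrow> ereal" where
  "theta_plus M s T = (if theta M s T = {} then \<infinity> else Sup (ereal ` theta M s T))"

definition gen_weighted_bisimulation :: "('s, 'p) wts \<Rightarrow> ('s \<times> 's) set \<Rightarrow> bool" where
  "gen_weighted_bisimulation M R \<longleftrightarrow>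
     equiv (states M) R \<and>
     (\<forall>(s, t)\<in>R. label M s = label M t \<and>
        (\<forall>T\<in>states M // R.
           theta_minus M s T = theta_minus M t T \<and>
           theta_plus M s T = theta_plus M t T))"

definition gen_weighted_bisimilarity :: "('s, 'p) wts \<Rightarrow> ('s \<times> 's) set" where
  "gen_weighted_bisimilarity M = \<Union> {R. gen_weighted_bisimulation M R}"

end

theory Submission
  imports Defs
begin

text \<open>
  The transitive closure of the union of all bisimulations is an equivalence relation, and each of
  its classes is a union of classes of any single bisimulation \<open>R\<close>. Infima and suprema over such a
  union are determined by those over the \<open>R\<close>-classes, provided one can tell which of these
  contribute no weight. The lower bound alone does so: weights are nonnegative, so
  \<open>\<theta>\<^sup>-\<close> is \<open>-\<infinity>\<close> exactly on the empty set of weights, whereas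
  \<open>\<theta>\<^sup>+ = \<infinity>\<close> may also come from an unbounded one.
\<close>

lemma theta_mono: "T \<subseteq> T' \<Longrightarrow> theta M s T \<subseteq> theta M s T'"
  unfolding theta_def by blast

lemma theta_minus_eq_minfty_iff:
  assumes "is_wts AP M"
  shows "theta_minus M s T = -\<infinity> \<longleftrightarrow> theta M s T = {}"
proof -
  \<comment> \<open>This also covers the empty set, whose \<open>Inf\<close> is \<infinity>.\<close>
  have "0 \<le> Inf (ereal ` theta M s T)"
    using assms by (intro Inf_greatest) (auto simp: theta_def is_wts_def)
  then show ?thesis by (auto simp: theta_minus_def)
qed

lemma gen_weighted_bisimulationD:
  assumes "gen_weighted_bisimulation M R" "(s, t) \<in> R"
  shows "label M s = label M t"
    and "T \<in> states M // R \<Longrightarrow> theta_minus M s T = theta_minus M t T"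
    and "T \<in> states M // R \<Longrightarrow> theta_plus M s T = theta_plus M t T"
  using assms unfolding gen_weighted_bisimulation_def by blast+

text \<open>A transition of weight \<open>r\<close> from \<open>s\<close> into \<open>T\<close> ends
  in some R-class \<open>C\<close>, and closure of \<open>T\<close> under \<open>R\<close> puts all
  of \<open>C\<close> inside \<open>T\<close>. Equal bounds on \<open>C\<close> then give
  \<open>t\<close> transitions into \<open>C\<close> whose weights enclose \<open>r\<close>, though
  \<open>r\<close> itself need not be among them.\<close>

lemma bisim_theta_closed:
  assumes M: "is_wts AP M" and R: "gen_weighted_bisimulation M R"
    and st: "(s, t) \<in> R" and T: "R `` T \<subseteq> T" and r: "r \<in> theta M s T"
  shows "theta M t T \<noteq> {}"
    and "Inf (ereal ` theta M t T) \<le> ereal r"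
    and "ereal r \<le> Sup (ereal ` theta M t T)"
proof -
  from r obtain u where u: "u \<in> T" "(s, r, u) \<in> transitions M"
    unfolding theta_def by blast
  have eq: "equiv (states M) R"
    using R by (simp add: gen_weighted_bisimulation_def)
  have "u \<in> states M" using M u(2) by (auto simp: is_wts_def)
  define C where "C = R `` {u}"
  have C: "C \<in> states M // R" and "u \<in> C" and "C \<subseteq> T"
    using \<open>u \<in> states M\<close> u(1) T equiv_class_self[OF eq] by (auto simp: C_def quotientI)
  have rC: "r \<in> theta M s C" using u \<open>u \<in> C\<close> by (auto simp: theta_def)
  note minus = gen_weighted_bisimulationD(2)[OF R st C]
  note plus = gen_weighted_bisimulationD(3)[OF R st C]
  \<comment> \<open>Once both weight sets over \<open>C\<close> are nonempty, the default values are
    excluded and the two bounds are genuine infima and suprema.\<close>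
  have ne: "theta M t C \<noteq> {}"
    using minus rC theta_minus_eq_minfty_iff[OF M] by (metis empty_iff)
  have sub: "ereal ` theta M t C \<subseteq> ereal ` theta M t T"
    using theta_mono[OF \<open>C \<subseteq> T\<close>] by (rule image_mono)
  show "theta M t T \<noteq> {}" using ne sub by blast
  have "Inf (ereal ` theta M t T) \<le> Inf (ereal ` theta M t C)"
    using sub by (rule Inf_superset_mono)
  also have "\<dots> = Inf (ereal ` theta M s C)"
    using minus ne rC by (auto simp: theta_minus_def split: if_splits)
  also have "\<dots> \<le> ereal r" using rC by (intro Inf_lower imageI)
  finally show "Inf (ereal ` theta M t T) \<le> ereal r" .
  have "ereal r \<le> Sup (ereal ` theta M s C)" using rC by (intro Sup_upper imageI)
  also have "\<dots> = Sup (ereal ` theta M t C)"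
    using plus ne rC by (auto simp: theta_plus_def split: if_splits)
  also have "\<dots> \<le> Sup (ereal ` theta M t T)"
    using sub by (rule Sup_subset_mono)
  finally show "ereal r \<le> Sup (ereal ` theta M t T)" .
qed

lemma bisim_theta_minus_plus_closed:
  assumes M: "is_wts AP M" and R: "gen_weighted_bisimulation M R"
    and st: "(s, t) \<in> R" and T: "R `` T \<subseteq> T"
  shows "theta_minus M s T = theta_minus M t T"
    and "theta_plus M s T = theta_plus M t T"
proof -
  have ts: "(t, s) \<in> R"
    using R st by (auto simp: gen_weighted_bisimulation_def equiv_def dest: symD)
  note st' = bisim_theta_closed[OF M R st T] and ts' = bisim_theta_closed[OF M R ts T]
  have empty: "theta M s T = {} \<longleftrightarrow> theta M t T = {}"
    using st'(1) ts'(1) by blast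
  \<comment> \<open>Each infimum bounds every weight of the other side from below, by symmetry of
    \<open>R\<close>. Empty sets need no separate case here; \<open>empty\<close> settles the
    default afterwards.\<close>
  have "Inf (ereal ` theta M s T) = Inf (ereal ` theta M t T)"
    by (intro antisym Inf_greatest) (auto intro: st'(2) ts'(2))
  then show "theta_minus M s T = theta_minus M t T"
    using empty by (simp add: theta_minus_def)
  have "Sup (ereal ` theta M s T) = Sup (ereal ` theta M t T)"
    by (intro antisym Sup_least) (auto intro: st'(3) ts'(3))
  then show "theta_plus M s T = theta_plus M t T"
    using empty by (simp add: theta_plus_def)
qed

lemma gen_weighted_bisimulation_Id_on:
  "gen_weighted_bisimulation M (Id_on (states M))"
  unfolding gen_weighted_bisimulation_def
  by (auto simp: equiv_def refl_on_def sym_Id_on trans_Id_on)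

lemma bisimulation_subset_bisimilarity:
  "gen_weighted_bisimulation M R \<Longrightarrow> R \<subseteq> gen_weighted_bisimilarity M"
  unfolding gen_weighted_bisimilarity_def by blast

text \<open>The identity bisimulation supplies reflexivity, symmetry is inherited from the members
  of the union, and the closure adds transitivity.\<close>

lemma equiv_trancl_bisimilarity:
  "equiv (states M) ((gen_weighted_bisimilarity M)\<^sup>+)"
proof -
  let ?U = "gen_weighted_bisimilarity M"
  have sub: "?U \<subseteq> states M \<times> states M"
    unfolding gen_weighted_bisimilarity_def gen_weighted_bisimulation_def
    by (auto dest: equiv_type)
  have "sym ?U"
    unfolding gen_weighted_bisimilarity_def gen_weighted_bisimulation_def
    by (intro symI) (auto simp: equiv_def dest: symD)
  moreover have "Id_on (states M) \<subseteq> ?U"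
    using gen_weighted_bisimulation_Id_on by (rule bisimulation_subset_bisimilarity)
  ultimately show ?thesis
    using trancl_subset_Sigma[OF sub]
    by (intro equivI) (auto simp: refl_on_def sym_trancl)
qed

lemma gen_weighted_bisimulation_trancl:
  assumes M: "is_wts AP M"
  shows "gen_weighted_bisimulation M ((gen_weighted_bisimilarity M)\<^sup>+)"
proof -
  let ?U = "gen_weighted_bisimilarity M"
  have step: "label M s = label M t \<and> (\<forall>T\<in>states M // ?U\<^sup>+.
      theta_minus M s T = theta_minus M t T \<and> theta_plus M s T = theta_plus M t T)"
    if st: "(s, t) \<in> ?U" for s t
  proof -
    from st obtain R where R: "gen_weighted_bisimulation M R" "(s, t) \<in> R"
      unfolding gen_weighted_bisimilarity_def by blast
    \<comment> \<open>An R-step is one more link in a chain of bisimilar states, so it cannot leave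
      a class of the closure.\<close>
    have closed: "R `` T \<subseteq> T" if "T \<in> states M // ?U\<^sup>+" for T
      using that bisimulation_subset_bisimilarity[OF R(1)]
      by (auto elim!: quotientE intro: trancl_into_trancl)
    show ?thesis
      using gen_weighted_bisimulationD(1)[OF R] bisim_theta_minus_plus_closed[OF M R closed]
      by simp
  qed
  \<comment> \<open>The classes \<open>T\<close> are those of the closure throughout, so the
    equalities compose along a chain.\<close>
  have "label M s = label M t \<and> (\<forall>T\<in>states M // ?U\<^sup>+.
      theta_minus M s T = theta_minus M t T \<and> theta_plus M s T = theta_plus M t T)"
    if "(s, t) \<in> ?U\<^sup>+" for s t
    using that by (induction rule: trancl_induct) (use step in \<open>simp_all\<close>)
  then show ?thesis
    using equiv_trancl_bisimilarity unfolding gen_weighted_bisimulation_def by blast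
qed

theorem theorem2p9:
  fixes AP :: "'p set" and M :: "('s, 'p) wts"
  assumes "is_wts AP M"
  shows "gen_weighted_bisimulation M (gen_weighted_bisimilarity M) \<and>
    (\<forall>R. gen_weighted_bisimulation M R \<longrightarrow> R \<subseteq> gen_weighted_bisimilarity M)"
proof -
  note bisim = gen_weighted_bisimulation_trancl[OF assms]
  \<comment> \<open>Being a bisimulation, the closure is itself a member of the union that it
    closes.\<close>
  have "(gen_weighted_bisimilarity M)\<^sup>+ = gen_weighted_bisimilarity M"
    using bisimulation_subset_bisimilarity[OF bisim] by auto
  then show ?thesis
    using bisim bisimulation_subset_bisimilarity by metis
qed

end
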